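(* Let $M,T,J\geq 1$ be integers with $MT\geq J$. Let $F$ be the group of feasibility-preserving permutations of $\mathrm{OSSP}(M,T,J)$ and let $S$ be its set of solutions. Then the action of $F$ on $S$ given by $(\rho,W)\mapsto\rho(W)$ is transitive.
   Context: Notation: $[n]=\{1,\ldots,n\}$. The constraint graph of the open-shop scheduling problem $\mathrm{OSSP}(M,T,J)$ is the simple undirected graph with vertex set $V=[M]\times[T]\times[J]$ in which two distinct vertices $(m,t,j)$ and $(m',t',j')$ are adjacent if and only if ($m=m'$ and $t=t'$) or $j=j'$. A solution is a subset $W\subseteq V$ with $|W|=J$ that is an independent set of this graph; equivalently $W=\{(m_j,t_j,j): j\in[J]\}$ with pairwise distinct positions $(m_j,t_j)\in[M]\times[T]$. $S$ is the set of all solutions. A permutation $\rho:V\to V$ is feasibility-preserving if $\rho(W)\in S$ for all $W\in S$; $F$ is the group of all feasibility-preserving permutations of $V$. *)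

theory Defs
  imports
    "HOL-Algebra.Group_Action"
    "Graph_Theory.Pair_Digraph"
begin

type_synonym vertex = "nat \<times> nat \<times> nat"

definition ossp_vertices :: "nat \<Rightarrow> nat \<Rightarrow> nat \<Rightarrow> vertex set" where
  "ossp_vertices M T J = {1..M} \<times> {1..T} \<times> {1..J}"

text \<open>A simple undirected graph is a symmetric loop-free digraph: an edge between \<open>u\<close> and \<open>v\<close> is the
  pair of arcs \<open>(u, v)\<close> and \<open>(v, u)\<close>.\<close>

definition ossp_graph :: "nat \<Rightarrow> nat \<Rightarrow> nat \<Rightarrow> vertex pair_pre_digraph" where
  "ossp_graph M T J =
     \<lparr> pverts = ossp_vertices M T J,
       parcs = {((m, t, j), (m', t', j')) | m t j m' t' j'.
         (m, t, j) \<in> ossp_vertices M T J \<and> (m', t', j') \<in> ossp_vertices M T J \<and>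
         (m, t, j) \<noteq> (m', t', j') \<and> (m = m' \<and> t = t' \<or> j = j')} \<rparr>"

lemma pair_graph_ossp_graph: "pair_graph (ossp_graph M T J)"
proof
  show "finite (pverts (ossp_graph M T J))"
    by (simp add: ossp_graph_def ossp_vertices_def)
  then have "finite (pverts (ossp_graph M T J) \<times> pverts (ossp_graph M T J))"
    by simp
  then show "finite (parcs (ossp_graph M T J))"
    by (rule rev_finite_subset) (auto simp: ossp_graph_def)
  show "symmetric (with_proj (ossp_graph M T J))"
    by (auto simp: symmetric_def sym_def ossp_graph_def)
qed (auto simp: ossp_graph_def)

definition independent_set :: "'a pair_pre_digraph \<Rightarrow> 'a set \<Rightarrow> bool" where
  "independent_set G W \<longleftrightarrow> W \<subseteq> pverts G \<and> (\<forall>u\<in>W. \<forall>v\<in>W. (u, v) \<notin> parcs G)"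

definition ossp_solutions :: "nat \<Rightarrow> nat \<Rightarrow> nat \<Rightarrow> vertex set set" where
  "ossp_solutions M T J = {W. independent_set (ossp_graph M T J) W \<and> card W = J}"

text \<open>Permutations of the vertex set are members of \<^const>\<open>Bij\<close>, i.e. functions that are
  \<open>undefined\<close> outside the vertex set, so that each permutation has a unique representative.\<close>

definition feasibility_preserving :: "nat \<Rightarrow> nat \<Rightarrow> nat \<Rightarrow> (vertex \<Rightarrow> vertex) set" where
  "feasibility_preserving M T J =
     {\<rho> \<in> Bij (ossp_vertices M T J). \<forall>W\<in>ossp_solutions M T J. \<rho> ` W \<in> ossp_solutions M T J}"

definition feasibility_group :: "nat \<Rightarrow> nat \<Rightarrow> nat \<Rightarrow> (vertex \<Rightarrow> vertex) monoid" where
  "feasibility_group M T J =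
     (BijGroup (ossp_vertices M T J))\<lparr>carrier := feasibility_preserving M T J\<rparr>"

end

theory Submission
  imports Defs
begin

text \<open>The family of solutions is finite, so a permutation mapping it into itself maps it onto itself;
  hence the feasibility-preserving permutations form a group acting on solutions. A solution assigns
  pairwise distinct positions to the jobs, so any two solutions are related by an injection between
  sets of positions. Extended to a permutation of all positions and applied to the first two
  coordinates of each vertex, it is a graph automorphism mapping one solution to the other.\<close>

section \<open>Permutations of a finite set that preserve a family of its subsets\<close>

lemma Bij_preserving_image_eq:
  assumes "finite V" and S: "S \<subseteq> Pow V" and f: "f \<in> Bij V" and pres: "\<forall>W\<in>S. f ` W \<in> S"
  shows "(`) f ` S = S"
proof (rule endo_inj_surj)
  show "finite S"
    using assms(1) S by (meson finite_Pow_iff finite_subset)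
  show "(`) f ` S \<subseteq> S"
    using pres by auto
  have "inj_on f V"
    using f by (simp add: Bij_def bij_betw_def)
  then show "inj_on ((`) f) S"
    by (rule inj_on_subset[OF inj_on_image_Pow S])
qed

text \<open>Closure under inverses is where finiteness enters: by
  \<open>Bij_preserving_image_eq\<close>, every \<open>W\<close> in \<open>S\<close> is the image
  under \<open>f\<close> of some \<open>X\<close> in \<open>S\<close>, and the inverse of
  \<open>f\<close> carries \<open>W\<close> back to \<open>X\<close>.\<close>

lemma subgroup_preserving_BijGroup:
  assumes "finite V" and S: "S \<subseteq> Pow V"
  shows "subgroup {f \<in> Bij V. \<forall>W\<in>S. f ` W \<in> S} (BijGroup V)" (is "subgroup ?F _")
proof (rule group.subgroupI[OF group_BijGroup])
  show "?F \<subseteq> carrier (BijGroup V)"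
    by (auto simp: BijGroup_def)
  have "(\<lambda>x\<in>V. x) ` W = W" if "W \<in> S" for W
    using that S by force
  then have "(\<lambda>x\<in>V. x) \<in> ?F"
    by (simp add: id_Bij)
  then show "?F \<noteq> {}"
    by blast
next
  fix f assume f: "f \<in> ?F"
  have "restrict (inv_into V f) V ` W \<in> S" if W: "W \<in> S" for W
  proof -
    obtain X where X: "X \<in> S" "W = f ` X"
      using Bij_preserving_image_eq[OF assms, of f] f W by blast
    have "inj_on f V"
      using f by (simp add: Bij_def bij_betw_def)
    moreover have "W \<subseteq> V" "X \<subseteq> V"
      using S W X(1) by auto
    moreover have "restrict (inv_into V f) V ` W = inv_into V f ` W"
      using \<open>W \<subseteq> V\<close> by (intro image_cong) auto
    ultimately show ?thesis
      using X by (simp add: inv_into_image_cancel)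
  qed
  then show "inv\<^bsub>BijGroup V\<^esub> f \<in> ?F"
    using f by (simp add: inv_BijGroup restrict_inv_into_Bij)
next
  fix f g assume fg: "f \<in> ?F" "g \<in> ?F"
  have "compose V f g ` W = f ` g ` W" if "W \<in> S" for W
    using that S by (force simp: compose_def)
  with fg show "f \<otimes>\<^bsub>BijGroup V\<^esub> g \<in> ?F"
    by (simp add: BijGroup_def compose_Bij)
qed

lemma group_action_preserving:
  assumes "finite V" and S: "S \<subseteq> Pow V"
  shows "group_action ((BijGroup V)\<lparr>carrier := {f \<in> Bij V. \<forall>W\<in>S. f ` W \<in> S}\<rparr>) S
           (\<lambda>f. \<lambda>W\<in>S. f ` W)" (is "group_action ?G S ?\<phi>")
proof -
  have bij: "?\<phi> f \<in> Bij S" if f: "f \<in> Bij V" "\<forall>W\<in>S. f ` W \<in> S" for f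
  proof -
    have "inj_on f V"
      using f by (simp add: Bij_def bij_betw_def)
    then have "inj_on ((`) f) S"
      by (rule inj_on_subset[OF inj_on_image_Pow S])
    then have "bij_betw ((`) f) S S"
      using Bij_preserving_image_eq[OF assms f] by (simp add: bij_betw_def)
    then show ?thesis
      by (simp add: Bij_def)
  qed
  \<comment> \<open>The condition on \<open>g\<close> keeps the image of \<open>W\<close> inside
    \<open>S\<close>, so the restricted map induced by \<open>f\<close> is not evaluated at a point
    where it is \<open>undefined\<close>.\<close>
  have mult: "?\<phi> (compose V f g) = compose S (?\<phi> f) (?\<phi> g)"
    if "\<forall>W\<in>S. g ` W \<in> S" for f g
  proof
    fix W
    have "compose V f g ` W = f ` g ` W" if "W \<in> S"
      using that S by (force simp: compose_def)
    then show "?\<phi> (compose V f g) W = compose S (?\<phi> f) (?\<phi> g) W"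
      using that by (simp add: compose_def)
  qed
  have "group ?G"
    by (intro subgroup.subgroup_is_group[OF subgroup_preserving_BijGroup group_BijGroup] assms)
  moreover have "?\<phi> \<in> hom ?G (BijGroup S)"
    using bij mult by (intro homI) (auto simp: BijGroup_def)
  ultimately show ?thesis
    by (intro group_action.intro group_hom.intro group_BijGroup group_hom_axioms.intro)
qed

text \<open>Both images have as many elements as \<open>A\<close>, so their complements in the
  finite set \<open>P\<close> are equinumerous. The map from \<open>p a\<close> to
  \<open>q a\<close> is glued to an arbitrary bijection \<open>h\<close> between these
  complements.\<close>

lemma bij_betw_extend_between_injections:
  assumes "finite P" and "inj_on p A" "inj_on q A" and sub: "p ` A \<subseteq> P" "q ` A \<subseteq> P"
  obtains \<sigma> where "bij_betw \<sigma> P P" and "\<And>a. a \<in> A \<Longrightarrow> \<sigma> (p a) = q a"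
proof -
  have "card (P - p ` A) = card (P - q ` A)"
    using assms by (simp add: card_Diff_subset finite_subset card_image)
  then obtain h where h: "bij_betw h (P - p ` A) (P - q ` A)"
    using finite_same_card_bij assms(1) by blast
  define g where "g = q \<circ> inv_into A p"
  define \<sigma> where "\<sigma> x = (if x \<in> p ` A then g x else h x)" for x
  have "bij_betw g (p ` A) (q ` A)"
    unfolding g_def using assms(2,3) by (meson bij_betw_inv_into bij_betw_trans inj_on_imp_bij_betw)
  then have "bij_betw \<sigma> (p ` A) (q ` A)"
    by (rule iffD1[OF bij_betw_cong, rotated]) (simp add: \<sigma>_def)
  moreover have "bij_betw \<sigma> (P - p ` A) (P - q ` A)"
    using h by (rule iffD1[OF bij_betw_cong, rotated]) (simp add: \<sigma>_def)
  ultimately have "bij_betw \<sigma> (p ` A \<union> (P - p ` A)) (q ` A \<union> (P - q ` A))"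
    by (rule bij_betw_combine) blast
  then have "bij_betw \<sigma> P P"
    using sub by (simp add: Un_absorb1)
  moreover have "\<sigma> (p a) = q a" if "a \<in> A" for a
    using that assms(2) by (simp add: \<sigma>_def g_def)
  ultimately show ?thesis
    by (rule that)
qed

section \<open>Solutions as injective assignments of positions to jobs\<close>

lemma finite_ossp_vertices: "finite (ossp_vertices M T J)"
  by (simp add: ossp_vertices_def)

text \<open>Two distinct vertices are adjacent exactly when the position projection or the job
  projection identifies them, so independence amounts to injectivity of both projections.\<close>

lemma ossp_solutions_iff:
  "W \<in> ossp_solutions M T J \<longleftrightarrow>
     W \<subseteq> ossp_vertices M T J \<and> inj_on (\<lambda>(m, t, j). (m, t)) W \<and> inj_on (\<lambda>(m, t, j). j) W \<and> card W = J"
proof -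
  have "independent_set (ossp_graph M T J) W \<longleftrightarrow> W \<subseteq> ossp_vertices M T J \<and>
      inj_on (\<lambda>(m, t, j). (m, t)) W \<and> inj_on (\<lambda>(m, t, j). j) W"
  proof (cases "W \<subseteq> ossp_vertices M T J")
    case True
    then have "(u, v) \<in> parcs (ossp_graph M T J) \<longleftrightarrow> u \<noteq> v \<and>
        ((\<lambda>(m, t, j). (m, t)) u = (\<lambda>(m, t, j). (m, t)) v \<or> (\<lambda>(m, t, j). j) u = (\<lambda>(m, t, j). j) v)"
      if "u \<in> W" "v \<in> W" for u v
      using that by (cases u; cases v) (auto simp: ossp_graph_def)
    with True show ?thesis
      unfolding independent_set_def inj_on_def by (simp add: ossp_graph_def) blast
  next
    case False
    then show ?thesis
      by (simp add: independent_set_def ossp_graph_def)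
  qed
  then show ?thesis
    by (simp add: ossp_solutions_def)
qed

lemma ossp_solutions_subset: "ossp_solutions M T J \<subseteq> Pow (ossp_vertices M T J)"
  by (auto simp: ossp_solutions_iff)

text \<open>A solution has \<open>J\<close> vertices with distinct jobs out of \<open>J\<close>, so
  each job occurs exactly once. The function \<open>p\<close> is the inverse of the job projection
  followed by the position projection.\<close>

lemma ossp_solution_positions:
  assumes "W \<in> ossp_solutions M T J"
  obtains p where "inj_on p {1..J}" and "p ` {1..J} \<subseteq> {1..M} \<times> {1..T}"
    and "W = (\<lambda>j. (fst (p j), snd (p j), j)) ` {1..J}"
proof -
  let ?job = "\<lambda>(m :: nat, t :: nat, j :: nat). j"
  let ?pos = "\<lambda>(m :: nat, t :: nat, j :: nat). (m, t)"
  have W: "W \<subseteq> ossp_vertices M T J" "inj_on ?pos W" "inj_on ?job W" "card W = J"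
    using assms by (auto simp: ossp_solutions_iff)
  have "?job ` W \<subseteq> {1..J}"
    using W(1) by (auto simp: ossp_vertices_def)
  then have job: "?job ` W = {1..J}"
    using W(3,4) by (intro card_subset_eq) (auto simp: card_image)
  \<comment> \<open>\<open>r j\<close> is the vertex of \<open>W\<close> that carries job
    \<open>j\<close>.\<close>
  define r where "r = inv_into W ?job"
  have bij: "bij_betw r {1..J} W"
    unfolding r_def using W(3) job by (metis bij_betw_inv_into inj_on_imp_bij_betw)
  have job_r: "?job (r j) = j" if "j \<in> {1..J}" for j
    unfolding r_def using that job by (metis f_inv_into_f)
  have "inj_on (?pos \<circ> r) {1..J}"
    using bij W(2) by (simp add: bij_betw_def comp_inj_on)
  moreover have "(?pos \<circ> r) ` {1..J} \<subseteq> {1..M} \<times> {1..T}"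
  proof -
    have "(?pos \<circ> r) ` {1..J} = ?pos ` W"
      using bij by (simp only: bij_betw_def image_comp [symmetric])
    then show ?thesis
      using W(1) by (auto simp: ossp_vertices_def)
  qed
  moreover have "W = (\<lambda>j. (fst ((?pos \<circ> r) j), snd ((?pos \<circ> r) j), j)) ` {1..J}"
  proof -
    have "(\<lambda>j. (fst ((?pos \<circ> r) j), snd ((?pos \<circ> r) j), j)) ` {1..J} = r ` {1..J}"
    proof (rule image_cong)
      fix j assume "j \<in> {1..J}"
      then show "(fst ((?pos \<circ> r) j), snd ((?pos \<circ> r) j), j) = r j"
        using job_r[of j] by (cases "r j") simp
    qed simp
    then show ?thesis
      using bij by (simp add: bij_betw_def)
  qed
  ultimately show ?thesis
    by (rule that)
qed

text \<open>The restriction to the vertex set makes the map extensional, as membership in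
  \<open>Bij\<close> demands.\<close>

definition move_positions ::
    "nat \<Rightarrow> nat \<Rightarrow> nat \<Rightarrow> (nat \<times> nat \<Rightarrow> nat \<times> nat) \<Rightarrow> vertex \<Rightarrow> vertex" where
  "move_positions M T J \<sigma> =
     (\<lambda>(m, t, j)\<in>ossp_vertices M T J. (fst (\<sigma> (m, t)), snd (\<sigma> (m, t)), j))"

lemma move_positions_feasibility_preserving:
  assumes "bij_betw \<sigma> ({1..M} \<times> {1..T}) ({1..M} \<times> {1..T})"
  shows "move_positions M T J \<sigma> \<in> feasibility_preserving M T J"
proof -
  let ?V = "ossp_vertices M T J" and ?\<rho> = "move_positions M T J \<sigma>"
  \<comment> \<open>Injectivity of \<sigma> in coordinates, the form in which it is met once
    \<open>move_positions\<close> is unfolded; the two vertices ensure that both positions lie in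
    the domain of \<sigma>.\<close>
  have \<sigma>_inj: "m = m' \<and> t = t'"
    if "fst (\<sigma> (m, t)) = fst (\<sigma> (m', t'))" "snd (\<sigma> (m, t)) = snd (\<sigma> (m', t'))"
      "(m, t, j) \<in> ?V" "(m', t', j') \<in> ?V" for m t j m' t' j'
    using prod_eqI[OF that(1,2)] that(3,4) assms
    by (auto simp: bij_betw_def ossp_vertices_def dest: inj_onD)
  have \<rho>: "?\<rho> (m, t, j) = (fst (\<sigma> (m, t)), snd (\<sigma> (m, t)), j)" if "(m, t, j) \<in> ?V" for m t j
    using that by (simp add: move_positions_def)
  have inj: "inj_on ?\<rho> ?V"
    by (auto simp: inj_on_def \<rho> dest: \<sigma>_inj)
  have "?\<rho> x \<in> ?V" if x: "x \<in> ?V" for x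
  proof -
    obtain m t j where "x = (m, t, j)"
      by (metis prod.exhaust)
    moreover from this x have "\<sigma> (m, t) \<in> {1..M} \<times> {1..T}"
      using bij_betwE[OF assms] by (auto simp: ossp_vertices_def)
    ultimately show ?thesis
      using x \<rho> by (auto simp: ossp_vertices_def mem_Times_iff)
  qed
  then have into: "?\<rho> ` ?V \<subseteq> ?V"
    by blast
  \<comment> \<open>An injective self-map of the finite vertex set is onto; the last
    \<open>simp\<close> call settles extensionality.\<close>
  then have "?\<rho> \<in> Bij ?V"
    using inj endo_inj_surj[OF finite_ossp_vertices]
    by (simp add: Bij_def bij_betw_def) (simp add: move_positions_def)
  moreover have "?\<rho> ` W \<in> ossp_solutions M T J" if W: "W \<in> ossp_solutions M T J" for W
  proof -
    have WV: "W \<subseteq> ?V" and pos: "inj_on (\<lambda>(m, t, j). (m, t)) W"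
      and job: "inj_on (\<lambda>(m, t, j). j) W" and "card W = J"
      using W by (auto simp: ossp_solutions_iff)
    \<comment> \<open>Jobs are left fixed, so on \<open>W\<close> the composite is the job
      projection itself.\<close>
    have "inj_on ((\<lambda>(m, t, j). j) \<circ> ?\<rho>) W"
    proof (subst inj_on_cong)
      show "((\<lambda>(m, t, j). j) \<circ> ?\<rho>) x = (\<lambda>(m, t, j). j) x" if "x \<in> W" for x
        using that WV by (cases x) (auto simp: \<rho>)
    qed (rule job)
    moreover have "inj_on ((\<lambda>(m, t, j). (m, t)) \<circ> ?\<rho>) W"
    proof (rule inj_onI)
      fix x y
      assume xy: "x \<in> W" "y \<in> W"
        and eq: "((\<lambda>(m, t, j). (m, t)) \<circ> ?\<rho>) x = ((\<lambda>(m, t, j). (m, t)) \<circ> ?\<rho>) y"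
      obtain m t j m' t' j' where [simp]: "x = (m, t, j)" "y = (m', t', j')"
        by (metis prod.exhaust)
      have V: "(m, t, j) \<in> ?V" "(m', t', j') \<in> ?V"
        using xy WV by auto
      \<comment> \<open>Equal positions after the move come from equal positions before it, and in a
        solution a position determines its vertex.\<close>
      then have "m = m' \<and> t = t'"
        using eq by (intro \<sigma>_inj) (auto simp: \<rho>)
      then show "x = y"
        using inj_onD[OF pos _ xy] by simp
    qed
    moreover have "?\<rho> ` W \<subseteq> ?V"
      using WV into by blast
    moreover have "card (?\<rho> ` W) = J"
      using inj_on_subset[OF inj WV] \<open>card W = J\<close> by (simp add: card_image)
    ultimately show ?thesis
      unfolding ossp_solutions_iff by (intro conjI inj_on_imageI)
  qed
  ultimately show ?thesis
    by (simp add: feasibility_preserving_def)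
qed

theorem theorem2:
  fixes M T J :: nat
  assumes "M \<ge> 1" and "T \<ge> 1" and "J \<ge> 1" and "M * T \<ge> J"
  shows "transitive_action (feasibility_group M T J) (ossp_solutions M T J)
           (\<lambda>\<rho>. \<lambda>W\<in>ossp_solutions M T J. \<rho> ` W)"
proof (intro transitive_action.intro transitive_action_axioms.intro)
  show "group_action (feasibility_group M T J) (ossp_solutions M T J)
           (\<lambda>\<rho>. \<lambda>W\<in>ossp_solutions M T J. \<rho> ` W)"
    unfolding feasibility_group_def feasibility_preserving_def
    by (rule group_action_preserving[OF finite_ossp_vertices ossp_solutions_subset])
next
  fix W X assume W: "W \<in> ossp_solutions M T J" and X: "X \<in> ossp_solutions M T J"
  obtain p where p: "inj_on p {1..J}" "p ` {1..J} \<subseteq> {1..M} \<times> {1..T}"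
    "W = (\<lambda>j. (fst (p j), snd (p j), j)) ` {1..J}"
    using W by (rule ossp_solution_positions)
  obtain q where q: "inj_on q {1..J}" "q ` {1..J} \<subseteq> {1..M} \<times> {1..T}"
    "X = (\<lambda>j. (fst (q j), snd (q j), j)) ` {1..J}"
    using X by (rule ossp_solution_positions)
  \<comment> \<open>Jobs index both solutions, so one permutation of the positions can send the
    position of each job in \<open>W\<close> to the position of the same job in
    \<open>X\<close>.\<close>
  obtain \<sigma> where \<sigma>: "bij_betw \<sigma> ({1..M} \<times> {1..T}) ({1..M} \<times> {1..T})"
    and \<sigma>_p: "\<And>j. j \<in> {1..J} \<Longrightarrow> \<sigma> (p j) = q j"
    by (rule bij_betw_extend_between_injections[OF _ p(1) q(1) p(2) q(2)]) auto
  \<comment> \<open>Membership in the vertex set lets \<open>move_positions\<close> be evaluated at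
    the vertices of \<open>W\<close>.\<close>
  have "(fst (p j), snd (p j), j) \<in> ossp_vertices M T J" if "j \<in> {1..J}" for j
    using that p(2) by (force simp: ossp_vertices_def)
  then have "move_positions M T J \<sigma> ` W = X"
    unfolding p(3) q(3) image_image
    by (intro image_cong) (simp_all add: move_positions_def \<sigma>_p)
  moreover have "move_positions M T J \<sigma> \<in> carrier (feasibility_group M T J)"
    using move_positions_feasibility_preserving[OF \<sigma>] by (simp add: feasibility_group_def)
  ultimately show "\<exists>\<rho>\<in>carrier (feasibility_group M T J).
      (\<lambda>W\<in>ossp_solutions M T J. \<rho> ` W) W = X"
    using W by auto
qed

end
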